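(* The function $\alpha\mapsto\xi_{\alpha,1-\alpha}$ is log-concave over $(0,1)\cap\mathbb Q$; that is, for all $\alpha,\alpha'\in(0,1)\cap\mathbb Q$ and all $\theta\in[0,1]\cap\mathbb Q$, $$\log\xi_{\alpha'',1-\alpha''}\ \ge\ \theta\log\xi_{\alpha,1-\alpha}+(1-\theta)\log\xi_{\alpha',1-\alpha'},\qquad \alpha''=\theta\alpha+(1-\theta)\alpha'.$$
   Context: For positive integers $d,k$, $\Xi_{d,k}$ denotes the maximal possible number of non-degenerate solutions in $\mathbb R_{>0}^d$ of a polynomial system $f_1=\dots=f_d=0$ with $f_1,\dots,f_d\in\mathbb R[X_1,\dots,X_d]$ that involves altogether at most $d+k+1$ distinct monomials with nonzero coefficients (this maximum is finite). Non-degenerate means that the Jacobian matrix of the system is invertible at the solution. For positive rationals $\alpha,\beta$, $\xi_{\alpha,\beta}:=\lim (\Xi_{\alpha n,\beta n})^{1/(\alpha n+\beta n)}\in[1,\infty]$, the limit being taken as $n\to\infty$ over positive integers $n$ with $\alpha n,\beta n\in\mathbb Z$; this limit is known to exist and to depend only on $\alpha/\beta$. Conventions: $\log\infty=\infty$, $0\cdot\infty=0$. *)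

theory Defs
  imports
    "HOL-Analysis.Derivative"
    "HOL-Library.Extended_Real"
    "HOL-Library.FuncSet"
    "HOL-Library.Poly_Mapping"
    "Jordan_Normal_Form.Matrix"
begin

text \<open>
  Since \<open>d\<close> varies inside the statement, real polynomials are finitely supported maps from
  exponent vectors to coefficients, over the variables \<open>X 0, X 1, \<dots>\<close>; the ring of polynomials
  in \<open>d\<close> variables consists of those that only involve \<open>X 0, \<dots>, X (d - 1)\<close>.
\<close>

type_synonym monomial = "nat \<Rightarrow>\<^sub>0 nat"
type_synonym real_mpoly = "monomial \<Rightarrow>\<^sub>0 real"

definition polys :: "nat \<Rightarrow> real_mpoly set" where
  "polys d = {p. \<forall>m \<in> Poly_Mapping.keys p. Poly_Mapping.keys m \<subseteq> {..<d}}"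

definition eval_monomial :: "monomial \<Rightarrow> (nat \<Rightarrow> real) \<Rightarrow> real" where
  "eval_monomial m x = (\<Prod>i \<in> Poly_Mapping.keys m. x i ^ Poly_Mapping.lookup m i)"

definition eval_poly :: "real_mpoly \<Rightarrow> (nat \<Rightarrow> real) \<Rightarrow> real" where
  "eval_poly p x =
     (\<Sum>m \<in> Poly_Mapping.keys p. Poly_Mapping.lookup p m * eval_monomial m x)"

definition partial_deriv :: "nat \<Rightarrow> ((nat \<Rightarrow> real) \<Rightarrow> real) \<Rightarrow> (nat \<Rightarrow> real) \<Rightarrow> real" where
  "partial_deriv j g x = deriv (\<lambda>t. g (x(j := t))) (x j)"

definition jacobian :: "nat \<Rightarrow> (nat \<Rightarrow> real_mpoly) \<Rightarrow> (nat \<Rightarrow> real) \<Rightarrow> real mat" where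
  "jacobian d f x = Matrix.mat d d (\<lambda>(i, j). partial_deriv j (eval_poly (f i)) x)"

text \<open>Points of \<open>\<real>\<^sub>>\<^sub>0\<^sup>d\<close> are extensional functions on \<open>{..<d}\<close>, so that each point is counted once.\<close>

definition positive_orthant :: "nat \<Rightarrow> (nat \<Rightarrow> real) set" where
  "positive_orthant d = ({..<d} \<rightarrow>\<^sub>E {0<..})"

definition nondegenerate_positive_solutions ::
    "nat \<Rightarrow> (nat \<Rightarrow> real_mpoly) \<Rightarrow> (nat \<Rightarrow> real) set" where
  "nondegenerate_positive_solutions d f =
     {x \<in> positive_orthant d. (\<forall>i<d. eval_poly (f i) x = 0) \<and> invertible_mat (jacobian d f x)}"

definition fewnomial_systems :: "nat \<Rightarrow> nat \<Rightarrow> (nat \<Rightarrow> real_mpoly) set" where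
  "fewnomial_systems d k =
     {f. (\<forall>i<d. f i \<in> polys d) \<and> card (\<Union>i<d. Poly_Mapping.keys (f i)) \<le> d + k + 1}"

definition ecard :: "'a set \<Rightarrow> enat" where
  "ecard A = (if finite A then enat (card A) else \<infinity>)"

text \<open>
  The maximal number of solutions is taken as a supremum in \<open>enat\<close>: it agrees with the
  maximum because that maximum is finite (fewnomial bound), and no value has to be invented
  for it before finiteness is known.
\<close>

definition Xi :: "nat \<Rightarrow> nat \<Rightarrow> enat" where
  "Xi d k = (SUP f \<in> fewnomial_systems d k. ecard (nondegenerate_positive_solutions d f))"

fun eroot :: "nat \<Rightarrow> enat \<Rightarrow> ereal" where
  "eroot N (enat m) = ereal (root N (real m))"
| "eroot N \<infinity> = \<infinity>"

text \<open>
  The limit runs along the \<open>n\<close> for which \<open>\<alpha> n\<close> and \<open>\<beta> n\<close> are integers; for those \<open>n\<close> the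
  floors in the definition are exact.
\<close>

definition xi :: "rat \<Rightarrow> rat \<Rightarrow> ereal" where
  "xi \<alpha> \<beta> =
     Lim (inf sequentially (principal {n. \<alpha> * of_nat n \<in> \<int> \<and> \<beta> * of_nat n \<in> \<int>}))
       (\<lambda>n. let d = nat \<lfloor>\<alpha> * of_nat n\<rfloor>; k = nat \<lfloor>\<beta> * of_nat n\<rfloor> in eroot (d + k) (Xi d k))"

definition elog :: "ereal \<Rightarrow> ereal" where
  "elog x = (if x \<le> 0 then -\<infinity> else if x = \<infinity> then \<infinity> else ereal (ln (real_of_ereal x)))"

end

theory Submission
  imports Defs
begin

text \<open>
  Two systems in disjoint sets of variables, scaled by monomials so that their supports share an
  exponent, form a system with at most \<open>d + e + (k + l) + 1\<close> monomials whose non-degenerate solutions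
  include all pairs, so \<open>Xi (d + e) (k + l) \<ge> Xi d k * Xi e l\<close>. By Fekete's argument the limit
  \<open>xi \<alpha> (1 - \<alpha>)\<close> is therefore the supremum of \<open>eroot n (Xi (\<alpha> n) ((1 - \<alpha>) n))\<close>. Given \<open>n\<close>
  and \<open>n'\<close> that nearly attain the suprema for \<open>\<alpha>\<close> and \<open>\<alpha>'\<close>, and \<open>\<theta> = r / q\<close>, combining
  \<open>r n'\<close> copies of the first system with \<open>(q - r) n\<close> copies of the second gives one of size
  \<open>q n n'\<close> for \<open>\<theta> \<alpha> + (1 - \<theta>) \<alpha>'\<close>. Lower bounds on \<open>Xi\<close> range over the natural numbers
  below it, which treats the value \<open>\<infinity>\<close> uniformly.
\<close>

section \<open>Lower bounds on \<open>Xi\<close> and their witnesses\<close>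

text \<open>A positive \<open>N\<close> below the supremum has a predecessor strictly below it,
  hence strictly below the count of some single system. Asking for a finite set of solutions treats
  systems with finitely and infinitely many solutions alike.\<close>

lemma le_Xi_iff:
  "enat N \<le> Xi d k \<longleftrightarrow>
    (\<exists>f \<in> fewnomial_systems d k. \<exists>S \<subseteq> nondegenerate_positive_solutions d f. finite S \<and> card S = N)"
  (is "?l \<longleftrightarrow> ?r")
proof
  assume ?l
  show ?r
  proof (cases N)
    case 0
    \<comment> \<open>Zero has no predecessor; any system serves here, with the empty set of
      solutions.\<close>
    have "(\<lambda>_. 0) \<in> fewnomial_systems d k"
      by (simp add: fewnomial_systems_def polys_def)
    then show ?thesis using 0 by (metis card.empty empty_subsetI finite.emptyI)
  next
    case (Suc M)
    then have "enat M < Xi d k"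
      using \<open>?l\<close> by (metis enat_ord_simps(2) lessI order_less_le_trans)
    then obtain f where f: "f \<in> fewnomial_systems d k"
      and M: "enat M < ecard (nondegenerate_positive_solutions d f)"
      unfolding Xi_def less_SUP_iff by blast
    have "\<exists>S \<subseteq> nondegenerate_positive_solutions d f. finite S \<and> card S = N"
    proof (cases "finite (nondegenerate_positive_solutions d f)")
      case True
      then have "N \<le> card (nondegenerate_positive_solutions d f)"
        using M Suc by (simp add: ecard_def)
      then show ?thesis by (metis obtain_subset_with_card_n)
    next
      case False
      then show ?thesis by (metis infinite_arbitrarily_large)
    qed
    then show ?thesis using f by blast
  qed
next
  assume ?r
  then obtain f S where f: "f \<in> fewnomial_systems d k"
    and S: "S \<subseteq> nondegenerate_positive_solutions d f" "finite S" "card S = N" by blast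
  have "enat N \<le> ecard (nondegenerate_positive_solutions d f)"
    using S by (auto simp: ecard_def intro: card_mono)
  also have "\<dots> \<le> Xi d k"
    unfolding Xi_def using f by (rule SUP_upper)
  finally show ?l .
qed

section \<open>Evaluation of monomials and polynomials\<close>

lemma eval_monomial_superset:
  assumes "finite I" "Poly_Mapping.keys m \<subseteq> I"
  shows "eval_monomial m x = (\<Prod>i\<in>I. x i ^ Poly_Mapping.lookup m i)"
  unfolding eval_monomial_def using assms
  by (intro prod.mono_neutral_left) (auto simp: in_keys_iff)

lemma eval_poly_superset:
  assumes "finite I" "Poly_Mapping.keys p \<subseteq> I"
  shows "eval_poly p x = (\<Sum>m\<in>I. Poly_Mapping.lookup p m * eval_monomial m x)"
  unfolding eval_poly_def using assms
  by (intro sum.mono_neutral_left) (auto simp: in_keys_iff)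

lemma eval_monomial_cong:
  assumes "Poly_Mapping.keys m \<subseteq> {..<d}" "\<And>i. i < d \<Longrightarrow> x i = y i"
  shows "eval_monomial m x = eval_monomial m y"
  unfolding eval_monomial_def using assms by (intro prod.cong) auto

lemma eval_poly_cong:
  assumes "p \<in> polys d" "\<And>i. i < d \<Longrightarrow> x i = y i"
  shows "eval_poly p x = eval_poly p y"
  unfolding eval_poly_def using assms
  by (intro sum.cong arg_cong2[where f="(*)"] eval_monomial_cong[of _ d]) (auto simp: polys_def)

lemma eval_monomial_pos:
  assumes "Poly_Mapping.keys m \<subseteq> {..<d}" "x \<in> positive_orthant d"
  shows "eval_monomial m x > 0"
  unfolding eval_monomial_def using assms
  by (intro prod_pos) (auto simp: positive_orthant_def PiE_iff)

lemma eval_poly_zero [simp]: "eval_poly 0 x = 0"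
  by (simp add: eval_poly_def)

lemma eval_poly_single [simp]: "eval_poly (Poly_Mapping.single m c) x = c * eval_monomial m x"
  by (subst eval_poly_superset[of "{m}"]) auto

lemma eval_poly_add [simp]: "eval_poly (p + q) x = eval_poly p x + eval_poly q x"
proof -
  let ?I = "Poly_Mapping.keys p \<union> Poly_Mapping.keys q"
  show ?thesis
    using Poly_Mapping.keys_add[of p q]
    by (simp add: eval_poly_superset[of ?I] lookup_add ring_distribs sum.distrib)
qed

lemma eval_poly_sum: "eval_poly (\<Sum>a\<in>A. p a) x = (\<Sum>a\<in>A. eval_poly (p a) x)"
  by (induction A rule: infinite_finite_induct) auto

text \<open>Needed to pull constants out of \<open>deriv\<close> along coordinate lines in the
  Jacobian.\<close>

lemma eval_poly_field_differentiable:
  "(\<lambda>t. eval_poly p (x(j := t))) field_differentiable at t0"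
proof -
  have pw: "(\<lambda>t. (x(j := t)) i ^ n) field_differentiable at t0" for i n
    by (cases "i = j") (auto intro!: derivative_intros)
  have "(\<lambda>t. \<Prod>i\<in>I. (x(j := t)) i ^ Poly_Mapping.lookup m i) field_differentiable at t0"
    if "finite I" for I and m :: monomial
    using that
  proof induction
    case empty
    show ?case by simp
  next
    case (insert i I)
    then show ?case
      using field_differentiable_mult[OF pw insert.IH]
      by (simp del: fun_upd_apply)
  qed
  then have "(\<lambda>t. eval_monomial m (x(j := t))) field_differentiable at t0" for m
    unfolding eval_monomial_def by simp
  then show ?thesis
    unfolding eval_poly_def
    by (intro field_differentiable_sum field_differentiable_mult field_differentiable_const) auto
qed

section \<open>Monomials, polynomials and points in two disjoint blocks of variables\<close>

text \<open>Built as a sum, so that coefficients add when \<phi> identifies two monomials; the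
  evaluation formula then holds without injectivity of \<phi>.\<close>

definition map_monomials :: "(monomial \<Rightarrow> monomial) \<Rightarrow> real_mpoly \<Rightarrow> real_mpoly" where
  "map_monomials \<phi> p =
     (\<Sum>m\<in>Poly_Mapping.keys p. Poly_Mapping.single (\<phi> m) (Poly_Mapping.lookup p m))"

lemma keys_map_monomials:
  "Poly_Mapping.keys (map_monomials \<phi> p) \<subseteq> \<phi> ` Poly_Mapping.keys p"
  unfolding map_monomials_def
  by (rule order_trans[OF Poly_Mapping.keys_sum]) (auto split: if_splits)

lemma eval_map_monomials:
  "eval_poly (map_monomials \<phi> p) x =
     (\<Sum>m\<in>Poly_Mapping.keys p. Poly_Mapping.lookup p m * eval_monomial (\<phi> m) x)"
  by (simp add: map_monomials_def eval_poly_sum)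

text \<open>The product of \<open>a\<close> in the first \<open>d\<close> variables with
  \<open>b\<close> shifted by \<open>d\<close> places.\<close>

definition join_monomial :: "nat \<Rightarrow> monomial \<Rightarrow> monomial \<Rightarrow> monomial" where
  "join_monomial d a b = Abs_poly_mapping
     (\<lambda>i. if i < d then Poly_Mapping.lookup a i else Poly_Mapping.lookup b (i - d))"

lemma lookup_join_monomial:
  "Poly_Mapping.lookup (join_monomial d a b) i =
     (if i < d then Poly_Mapping.lookup a i else Poly_Mapping.lookup b (i - d))"
proof -
  let ?f = "\<lambda>i. if i < d then Poly_Mapping.lookup a i else Poly_Mapping.lookup b (i - d)"
  have "{i. ?f i \<noteq> 0} \<subseteq> {..<d} \<union> (+) d ` Poly_Mapping.keys b"
  proof
    fix i assume "i \<in> {i. ?f i \<noteq> 0}"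
    then have "i < d \<or> (i = d + (i - d) \<and> i - d \<in> Poly_Mapping.keys b)"
      by (auto simp: in_keys_iff split: if_splits)
    then show "i \<in> {..<d} \<union> (+) d ` Poly_Mapping.keys b"
      by blast
  qed
  then have "finite {i. ?f i \<noteq> 0}"
    by (rule finite_subset) auto
  then show ?thesis
    unfolding join_monomial_def by (subst Abs_poly_mapping_inverse) auto
qed

lemma keys_join_monomial:
  assumes "Poly_Mapping.keys b \<subseteq> {..<e}"
  shows "Poly_Mapping.keys (join_monomial d a b) \<subseteq> {..<d + e}"
proof
  fix i assume "i \<in> Poly_Mapping.keys (join_monomial d a b)"
  then have "i < d \<or> i - d \<in> Poly_Mapping.keys b"
    by (auto simp: in_keys_iff lookup_join_monomial split: if_splits)
  then show "i \<in> {..<d + e}"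
    using assms by auto
qed

lemma prod_lessThan_add:
  fixes g :: "nat \<Rightarrow> 'a :: comm_monoid_mult"
  shows "(\<Prod>i<d + e. g i) = (\<Prod>i<d. g i) * (\<Prod>i<e. g (d + i))"
  by (induction e) (auto simp: mult.assoc)

lemma eval_join_monomial:
  assumes "Poly_Mapping.keys a \<subseteq> {..<d}" "Poly_Mapping.keys b \<subseteq> {..<e}"
  shows "eval_monomial (join_monomial d a b) z = eval_monomial a z * eval_monomial b (\<lambda>i. z (d + i))"
  using assms keys_join_monomial[OF assms(2), of d a]
  by (simp add: eval_monomial_superset[of "{..<d + e}"] eval_monomial_superset[of "{..<d}"]
      eval_monomial_superset[of "{..<e}" b] prod_lessThan_add lookup_join_monomial)

lemma eval_map_join_left:
  assumes "p \<in> polys d" "Poly_Mapping.keys b \<subseteq> {..<e}"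
  shows "eval_poly (map_monomials (\<lambda>m. join_monomial d m b) p) z =
           eval_poly p z * eval_monomial b (\<lambda>i. z (d + i))"
proof -
  have "eval_monomial (join_monomial d m b) z = eval_monomial m z * eval_monomial b (\<lambda>i. z (d + i))"
    if "m \<in> Poly_Mapping.keys p" for m
    using that assms by (intro eval_join_monomial) (auto simp: polys_def)
  then show ?thesis
    by (simp add: eval_map_monomials eval_poly_def[of p] sum_distrib_right mult.assoc)
qed

lemma eval_map_join_right:
  assumes "Poly_Mapping.keys a \<subseteq> {..<d}" "p \<in> polys e"
  shows "eval_poly (map_monomials (join_monomial d a) p) z =
           eval_monomial a z * eval_poly p (\<lambda>i. z (d + i))"
proof -
  have "eval_monomial (join_monomial d a m) z = eval_monomial a z * eval_monomial m (\<lambda>i. z (d + i))"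
    if "m \<in> Poly_Mapping.keys p" for m
    using that assms by (intro eval_join_monomial) (auto simp: polys_def)
  then show ?thesis
    by (simp add: eval_map_monomials eval_poly_def[of p] sum_distrib_left mult_ac)
qed

definition join_point :: "nat \<Rightarrow> nat \<Rightarrow> (nat \<Rightarrow> real) \<Rightarrow> (nat \<Rightarrow> real) \<Rightarrow> nat \<Rightarrow> real" where
  "join_point d e x y = (\<lambda>i\<in>{..<d + e}. if i < d then x i else y (i - d))"

lemma join_point_in_orthant:
  assumes "x \<in> positive_orthant d" "y \<in> positive_orthant e"
  shows "join_point d e x y \<in> positive_orthant (d + e)"
  using assms by (auto simp: positive_orthant_def join_point_def PiE_iff)

lemma inj_join_point:
  "inj_on (\<lambda>(x, y). join_point d e x y) (positive_orthant d \<times> positive_orthant e)"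
proof (rule inj_onI, clarify)
  fix x y x' y'
  assume x: "x \<in> positive_orthant d" "x' \<in> positive_orthant d"
    and y: "y \<in> positive_orthant e" "y' \<in> positive_orthant e"
    and eq: "join_point d e x y = join_point d e x' y'"
  have "x i = x' i" if "i < d" for i
    using fun_cong[OF eq, of i] that by (simp add: join_point_def)
  moreover have "y i = y' i" if "i < e" for i
    using fun_cong[OF eq, of "d + i"] that by (simp add: join_point_def)
  ultimately show "x = x' \<and> y = y'"
    using x y unfolding positive_orthant_def by (metis PiE_ext lessThan_iff)
qed

section \<open>The joined system, its Jacobian and its support\<close>

lemma invertible_smult_mat:
  fixes A :: "'a :: field mat"
  assumes "invertible_mat A" "c \<noteq> 0"
  shows "invertible_mat (c \<cdot>\<^sub>m A)"
proof -
  obtain B n where A: "A \<in> carrier_mat n n" and B: "B \<in> carrier_mat n n"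
    and AB: "A * B = 1\<^sub>m n" "B * A = 1\<^sub>m n"
    using assms(1) unfolding invertible_mat_def inverts_mat_def square_mat.simps
    by (metis carrier_matI index_mult_mat(2,3) index_one_mat(2,3))
  have one: "c \<cdot>\<^sub>m (inverse c \<cdot>\<^sub>m 1\<^sub>m n) = 1\<^sub>m n" "inverse c \<cdot>\<^sub>m (c \<cdot>\<^sub>m 1\<^sub>m n) = 1\<^sub>m n"
    using assms(2) by (intro eq_matI; simp)+
  have "(c \<cdot>\<^sub>m A) * (inverse c \<cdot>\<^sub>m B) = 1\<^sub>m n" "(inverse c \<cdot>\<^sub>m B) * (c \<cdot>\<^sub>m A) = 1\<^sub>m n"
    using A B AB one
    by (simp_all add: mult_smult_distrib[of _ n n] mult_smult_assoc_mat[of _ n n])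
  then show ?thesis
    unfolding invertible_mat_def inverts_mat_def using A B by auto
qed

lemma invertible_block_diag:
  fixes A B :: "'a :: field mat"
  assumes "invertible_mat A" "invertible_mat B"
    and A: "A \<in> carrier_mat n n" and B: "B \<in> carrier_mat m m"
  shows "invertible_mat (four_block_mat A (0\<^sub>m n m) (0\<^sub>m m n) B)"
proof -
  obtain A' where A': "A' \<in> carrier_mat n n" "A * A' = 1\<^sub>m n" "A' * A = 1\<^sub>m n"
    using assms(1) A unfolding invertible_mat_def inverts_mat_def
    by (metis carrier_matD carrier_matI index_mult_mat(2,3) index_one_mat(2,3))
  obtain B' where B': "B' \<in> carrier_mat m m" "B * B' = 1\<^sub>m m" "B' * B = 1\<^sub>m m"
    using assms(2) B unfolding invertible_mat_def inverts_mat_def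
    by (metis carrier_matD carrier_matI index_mult_mat(2,3) index_one_mat(2,3))
  let ?C = "four_block_mat A (0\<^sub>m n m) (0\<^sub>m m n) B"
  let ?D = "four_block_mat A' (0\<^sub>m n m) (0\<^sub>m m n) B'"
  have "?C * ?D = 1\<^sub>m (n + m)"
    using A B A' B' by (subst mult_four_block_mat[of _ n n _ m _ m]) auto
  moreover have "?D * ?C = 1\<^sub>m (n + m)"
    using A B A' B' by (subst mult_four_block_mat[of _ n n _ m _ m]) auto
  ultimately show ?thesis
    unfolding invertible_mat_def inverts_mat_def using A B A' B' by auto
qed

text \<open>
  Multiplying the \<open>f i\<close> by the second block's monomial \<open>b\<close> and the \<open>g i\<close> by the first block's
  \<open>a\<close> makes both supports contain the product of \<open>a\<close> and \<open>b\<close>, without negative exponents.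
\<close>

definition join_system ::
    "nat \<Rightarrow> monomial \<Rightarrow> monomial \<Rightarrow> (nat \<Rightarrow> real_mpoly) \<Rightarrow> (nat \<Rightarrow> real_mpoly) \<Rightarrow> nat \<Rightarrow> real_mpoly" where
  "join_system d a b f g i =
     (if i < d then map_monomials (\<lambda>m. join_monomial d m b) (f i)
      else map_monomials (join_monomial d a) (g (i - d)))"

text \<open>Each polynomial of the joined system is a factor in one block of variables times a
  monomial in the other. The factor vanishes at the solution, so the Jacobian is block diagonal; the
  monomials are positive there, so they scale the two Jacobians by nonzero constants.\<close>

lemma join_solution:
  assumes f: "\<And>i. i < d \<Longrightarrow> f i \<in> polys d" and g: "\<And>i. i < e \<Longrightarrow> g i \<in> polys e"
    and a: "Poly_Mapping.keys a \<subseteq> {..<d}" and b: "Poly_Mapping.keys b \<subseteq> {..<e}"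
    and x: "x \<in> nondegenerate_positive_solutions d f"
    and y: "y \<in> nondegenerate_positive_solutions e g"
  shows "join_point d e x y \<in> nondegenerate_positive_solutions (d + e) (join_system d a b f g)"
proof -
  define z where "z = join_point d e x y"
  define ca where "ca = eval_monomial a x"
  define cb where "cb = eval_monomial b y"
  have xpos: "x \<in> positive_orthant d" and ypos: "y \<in> positive_orthant e"
    and fx: "\<And>i. i < d \<Longrightarrow> eval_poly (f i) x = 0" and gy: "\<And>i. i < e \<Longrightarrow> eval_poly (g i) y = 0"
    and Jx: "invertible_mat (jacobian d f x)" and Jy: "invertible_mat (jacobian e g y)"
    using x y by (auto simp: nondegenerate_positive_solutions_def)
  have ca: "ca \<noteq> 0" and cb: "cb \<noteq> 0"
    using eval_monomial_pos[OF a xpos] eval_monomial_pos[OF b ypos] by (auto simp: ca_def cb_def)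
  have zl: "z i = x i" if "i < d" for i
    using that by (simp add: z_def join_point_def)
  have zr: "z (d + i) = y i" if "i < e" for i
    using that by (simp add: z_def join_point_def)
  have evl: "eval_poly (join_system d a b f g i) w = eval_poly (f i) w * eval_monomial b (\<lambda>i. w (d + i))"
    if "i < d" for i w
    using that eval_map_join_left[OF f b] by (simp add: join_system_def)
  have evr: "eval_poly (join_system d a b f g (d + i)) w = eval_monomial a w * eval_poly (g i) (\<lambda>i. w (d + i))"
    if "i < e" for i w
    using that eval_map_join_right[OF a g] by (simp add: join_system_def)
  have fz: "eval_poly (f i) z = 0" if "i < d" for i
    using eval_poly_cong[OF f[OF that], of z x] zl fx that by simp
  have gz: "eval_poly (g i) (\<lambda>i. z (d + i)) = 0" if "i < e" for i
    using eval_poly_cong[OF g[OF that], of "\<lambda>i. z (d + i)" y] zr gy that by simp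
  have "eval_poly (join_system d a b f g i) z = 0" if "i < d + e" for i
    using evl[of i z] evr[of "i - d" z] fz gz that by (cases "i < d") auto
  moreover have "jacobian (d + e) (join_system d a b f g) z =
      four_block_mat (cb \<cdot>\<^sub>m jacobian d f x) (0\<^sub>m d e) (0\<^sub>m e d) (ca \<cdot>\<^sub>m jacobian e g y)"
    (is "?J = ?B")
  proof (rule eq_matI)
    \<comment> \<open>Along a coordinate of the first block the monomial \<open>b\<close> keeps its
      value \<open>cb\<close>, so no product rule is needed.\<close>
    have ll: "?J $$ (i, j) = cb * partial_deriv j (eval_poly (f i)) x" if "i < d" "j < d" for i j
    proof -
      have "eval_poly (join_system d a b f g i) (z(j := t)) = cb * eval_poly (f i) (x(j := t))" for t
        using that eval_poly_cong[OF f[OF that(1)], of "z(j := t)" "x(j := t)"] zl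
          eval_monomial_cong[OF b, of "\<lambda>i. (z(j := t)) (d + i)" y] zr
        by (simp add: evl cb_def)
      then show ?thesis
        using that zl eval_poly_field_differentiable
        by (simp add: jacobian_def partial_deriv_def deriv_cmult)
    qed
    have rr: "?J $$ (d + i, d + j) = ca * partial_deriv j (eval_poly (g i)) y" if "i < e" "j < e" for i j
    proof -
      have "eval_poly (join_system d a b f g (d + i)) (z(d + j := t)) = ca * eval_poly (g i) (y(j := t))" for t
        using that eval_poly_cong[OF g[OF that(1)], of "\<lambda>i. (z(d + j := t)) (d + i)" "y(j := t)"] zr
          eval_monomial_cong[OF a, of "z(d + j := t)" x] zl
        by (simp add: evr ca_def)
      then show ?thesis
        using that zr eval_poly_field_differentiable
        by (simp add: jacobian_def partial_deriv_def deriv_cmult)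
    qed
    \<comment> \<open>The factor \<open>f i\<close> does not see this variable and is zero at
      \<open>z\<close>, so the product vanishes along the whole line.\<close>
    have lr: "?J $$ (i, d + j) = 0" if "i < d" "j < e" for i j
    proof -
      have "eval_poly (join_system d a b f g i) (z(d + j := t)) = 0" for t
        using that eval_poly_cong[OF f[OF that(1)], of "z(d + j := t)" z] fz by (simp add: evl)
      then show ?thesis
        using that by (simp add: jacobian_def partial_deriv_def)
    qed
    have rl: "?J $$ (d + i, j) = 0" if "i < e" "j < d" for i j
    proof -
      have "eval_poly (join_system d a b f g (d + i)) (z(j := t)) = 0" for t
        using that eval_poly_cong[OF g[OF that(1)], of "\<lambda>i. (z(j := t)) (d + i)" "\<lambda>i. z (d + i)"] gz
        by (simp add: evr)
      then show ?thesis
        using that by (simp add: jacobian_def partial_deriv_def)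
    qed
    fix i j assume "i < dim_row ?B" "j < dim_col ?B"
    then have ij: "i < d + e" "j < d + e" by (auto simp: jacobian_def)
    show "?J $$ (i, j) = ?B $$ (i, j)"
      using ij ll[of i j] lr[of i "j - d"] rl[of "i - d" j] rr[of "i - d" "j - d"]
      by (cases "i < d"; cases "j < d") (auto simp: jacobian_def)
  qed (auto simp: jacobian_def)
  moreover have "invertible_mat \<dots>"
    using Jx Jy ca cb by (intro invertible_block_diag invertible_smult_mat) (auto simp: jacobian_def)
  ultimately show ?thesis
    using join_point_in_orthant[OF xpos ypos]
    by (simp add: nondegenerate_positive_solutions_def z_def)
qed

text \<open>The shared exponent is counted once. This saving turns
  \<open>(d + k + 1) + (e + l + 1)\<close> into \<open>(d + e) + (k + l) + 1\<close>.\<close>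

lemma Suc_card_Un_image_le:
  assumes "finite A" "finite B" "a \<in> A" "b \<in> B" "\<phi> a = \<psi> b"
  shows "Suc (card (\<phi> ` A \<union> \<psi> ` B)) \<le> card A + card B"
proof -
  have "\<phi> a \<in> \<phi> ` A \<inter> \<psi> ` B"
    using imageI[OF assms(3), of \<phi>] imageI[OF assms(4), of \<psi>] assms(5) by simp
  then have "0 < card (\<phi> ` A \<inter> \<psi> ` B)"
    using assms(1) by (auto simp: card_gt_0_iff)
  then show ?thesis
    using card_Un_Int[of "\<phi> ` A" "\<psi> ` B"] card_image_le[OF assms(1), of \<phi>]
      card_image_le[OF assms(2), of \<psi>] assms(1,2) by simp
qed

lemma join_system_fewnomial:
  assumes f: "f \<in> fewnomial_systems d k" and g: "g \<in> fewnomial_systems e l"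
  obtains a b where "Poly_Mapping.keys a \<subseteq> {..<d}" "Poly_Mapping.keys b \<subseteq> {..<e}"
    "join_system d a b f g \<in> fewnomial_systems (d + e) (k + l)"
proof -
  define A where "A = (\<Union>i<d. Poly_Mapping.keys (f i))"
  define B where "B = (\<Union>i<e. Poly_Mapping.keys (g i))"
  have fin: "finite A" "finite B"
    by (auto simp: A_def B_def)
  have card: "card A \<le> d + k + 1" "card B \<le> e + l + 1"
    using f g by (auto simp: A_def B_def fewnomial_systems_def)
  have kA: "Poly_Mapping.keys m \<subseteq> {..<d}" if "m \<in> A" for m
    using that f by (force simp: A_def fewnomial_systems_def polys_def)
  have kB: "Poly_Mapping.keys m \<subseteq> {..<e}" if "m \<in> B" for m
    using that g by (force simp: B_def fewnomial_systems_def polys_def)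
  \<comment> \<open>With an empty support there is no exponent to share; the default 0 is the
    constant monomial 1, which respects every range of variables.\<close>
  define a where "a = (if A = {} then 0 else SOME a. a \<in> A)"
  define b where "b = (if B = {} then 0 else SOME b. b \<in> B)"
  have aA: "a \<in> A" if "A \<noteq> {}" using that by (simp add: a_def some_in_eq)
  have bB: "b \<in> B" if "B \<noteq> {}" using that by (simp add: b_def some_in_eq)
  have a: "Poly_Mapping.keys a \<subseteq> {..<d}" using aA kA by (cases "A = {}") (auto simp: a_def)
  have b: "Poly_Mapping.keys b \<subseteq> {..<e}" using bB kB by (cases "B = {}") (auto simp: b_def)
  let ?\<phi> = "\<lambda>m. join_monomial d m b" and ?\<psi> = "join_monomial d a"
  have keysl: "Poly_Mapping.keys (join_system d a b f g i) \<subseteq> ?\<phi> ` A" if "i < d" for i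
    using that keys_map_monomials[of ?\<phi> "f i"] by (force simp: join_system_def A_def)
  have keysr: "Poly_Mapping.keys (join_system d a b f g i) \<subseteq> ?\<psi> ` B" if "\<not> i < d" "i < d + e" for i
    using that keys_map_monomials[of ?\<psi> "g (i - d)"] by (force simp: join_system_def B_def)
  have "join_system d a b f g i \<in> polys (d + e)" if "i < d + e" for i
  proof -
    have "Poly_Mapping.keys (join_monomial d m b) \<subseteq> {..<d + e}" for m
      using b by (rule keys_join_monomial)
    moreover have "Poly_Mapping.keys (join_monomial d a m) \<subseteq> {..<d + e}" if "m \<in> B" for m
      using kB[OF that] by (rule keys_join_monomial)
    ultimately show ?thesis
      using that keysl[of i] keysr[of i] unfolding polys_def by (cases "i < d") blast+
  qed
  moreover have "card (\<Union>i<d + e. Poly_Mapping.keys (join_system d a b f g i)) \<le> (d + e) + (k + l) + 1"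
  proof -
    have "(\<Union>i<d + e. Poly_Mapping.keys (join_system d a b f g i)) \<subseteq> ?\<phi> ` A \<union> ?\<psi> ` B"
      using keysl keysr by blast
    then have "card (\<Union>i<d + e. Poly_Mapping.keys (join_system d a b f g i)) \<le> card (?\<phi> ` A \<union> ?\<psi> ` B)"
      using fin by (intro card_mono) auto
    also have "\<dots> \<le> (d + e) + (k + l) + 1"
    \<comment> \<open>If one support is empty, the other alone stays within the bound. Otherwise
      \<open>join_monomial d a b\<close> lies in both images.\<close>
    proof (cases "A = {} \<or> B = {}")
      case True
      then show ?thesis
        using card card_image_le[OF fin(1), of ?\<phi>] card_image_le[OF fin(2), of ?\<psi>] by auto
    next
      case False
      then show ?thesis
        using Suc_card_Un_image_le[OF fin aA bB, of ?\<phi> ?\<psi>] card by simp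
    qed
    finally show ?thesis .
  qed
  ultimately have "join_system d a b f g \<in> fewnomial_systems (d + e) (k + l)"
    by (simp add: fewnomial_systems_def)
  then show thesis using a b that by blast
qed

section \<open>Products and powers of lower bounds\<close>

text \<open>Joining points is injective, so the pairs from two witness sets give distinct solutions
  of the joined system.\<close>

lemma Xi_supermultiplicative:
  assumes "enat M \<le> Xi d k" "enat N \<le> Xi e l"
  shows "enat (M * N) \<le> Xi (d + e) (k + l)"
proof -
  obtain f S where f: "f \<in> fewnomial_systems d k"
    and S: "S \<subseteq> nondegenerate_positive_solutions d f" "finite S" "card S = M"
    using assms(1) le_Xi_iff by auto
  obtain g T where g: "g \<in> fewnomial_systems e l"
    and T: "T \<subseteq> nondegenerate_positive_solutions e g" "finite T" "card T = N"
    using assms(2) le_Xi_iff by auto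
  obtain a b where a: "Poly_Mapping.keys a \<subseteq> {..<d}" and b: "Poly_Mapping.keys b \<subseteq> {..<e}"
    and h: "join_system d a b f g \<in> fewnomial_systems (d + e) (k + l)"
    using join_system_fewnomial[OF f g] .
  let ?U = "(\<lambda>(x, y). join_point d e x y) ` (S \<times> T)"
  have "inj_on (\<lambda>(x, y). join_point d e x y) (S \<times> T)"
    using S(1) T(1)
    by (intro inj_on_subset[OF inj_join_point]) (auto simp: nondegenerate_positive_solutions_def)
  then have "card ?U = M * N"
    using S T by (simp add: card_image card_cartesian_product)
  moreover have "?U \<subseteq> nondegenerate_positive_solutions (d + e) (join_system d a b f g)"
    using S(1) T(1) f g join_solution[OF _ _ a b, of f g]
    by (force simp: fewnomial_systems_def)
  ultimately show ?thesis
    unfolding le_Xi_iff using h S(2) T(2) by (intro bexI[OF _ h] exI[of _ ?U]) auto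
qed

text \<open>The system \<open>X i - 1\<close> has the monomials \<open>X i\<close> and the constant,
  at most \<open>d + 1\<close> in all, and its Jacobian at the all-ones point is the identity. The
  bound starts the powers, covers remainders in Fekete's argument and keeps the logarithms
  nonnegative.\<close>

lemma one_le_Xi: "enat 1 \<le> Xi d k"
proof -
  define X :: "nat \<Rightarrow> monomial" where "X i = Poly_Mapping.single i 1" for i
  define f :: "nat \<Rightarrow> real_mpoly" where
    "f i = Poly_Mapping.single (X i) 1 + Poly_Mapping.single 0 (- 1)" for i
  define x where "x = (\<lambda>i\<in>{..<d}. 1 :: real)"
  have ev: "eval_poly (f i) y = y i - 1" for i y
    by (simp add: f_def X_def eval_monomial_def)
  have keys: "Poly_Mapping.keys (f i) \<subseteq> {X i, 0}" for i
    using Poly_Mapping.keys_add[of "Poly_Mapping.single (X i) 1" "Poly_Mapping.single 0 (- 1)"]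
    by (auto simp: f_def)
  have "card (\<Union>i<d. Poly_Mapping.keys (f i)) \<le> card (insert 0 (X ` {..<d}))"
    using keys by (intro card_mono) auto
  also have "\<dots> \<le> Suc (card {..<d})"
    using card_image_le[of "{..<d}" X] by (simp add: card_insert_if)
  finally have "card (\<Union>i<d. Poly_Mapping.keys (f i)) \<le> d + k + 1" by simp
  moreover have "f i \<in> polys d" if "i < d" for i
    using keys[of i] that by (auto simp: polys_def X_def)
  ultimately have f: "f \<in> fewnomial_systems d k"
    by (simp add: fewnomial_systems_def)
  have "partial_deriv j (eval_poly (f i)) x = (if i = j then 1 else 0)" for i j
    by (auto simp: partial_deriv_def ev intro!: DERIV_imp_deriv derivative_eq_intros)
  then have "jacobian d f x = 1\<^sub>m d"
    by (auto simp: jacobian_def)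
  then have "x \<in> nondegenerate_positive_solutions d f"
    by (auto simp: nondegenerate_positive_solutions_def positive_orthant_def x_def ev
        invertible_mat_def inverts_mat_def intro!: exI[of _ "1\<^sub>m d"])
  then show ?thesis
    unfolding le_Xi_iff by (intro bexI[OF _ f] exI[of _ "{x}"]) auto
qed

lemma Xi_power:
  assumes "enat N \<le> Xi d k"
  shows "enat (N ^ n) \<le> Xi (n * d) (n * k)"
proof (induction n)
  case 0
  show ?case using one_le_Xi[of 0 0] by simp
next
  case (Suc n)
  show ?case using Xi_supermultiplicative[OF assms Suc] by simp
qed

section \<open>Fekete's argument for roots\<close>

lemma ereal_le_eroot_iff:
  assumes "0 \<le> x" "0 < n"
  shows "ereal x \<le> eroot n e \<longleftrightarrow> (\<exists>N. enat N \<le> e \<and> x ^ n \<le> real N)"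
proof (cases e)
  case (enat m)
  have "ereal x \<le> eroot n e \<longleftrightarrow> x ^ n \<le> real m"
    using assms enat
    by (metis eroot.simps(1) ereal_less_eq(3) of_nat_0_le_iff real_root_le_iff real_root_power_cancel)
  also have "\<dots> \<longleftrightarrow> (\<exists>N\<le>m. x ^ n \<le> real N)"
    by (meson of_nat_mono order_refl order_trans)
  finally show ?thesis using enat by auto
next
  case infinity
  then show ?thesis using real_arch_simple by auto
qed

text \<open>Closure under truncated subtraction puts 0 and remainders modulo positive elements into
  \<open>S\<close>. The terms never exceed \<open>L\<close>; conversely, writing
  \<open>n = q * n0 + r\<close> with \<open>r < n0\<close> bounds \<open>E n\<close> below by
  \<open>q\<close> factors from \<open>n0\<close> and a factor 1 from \<open>r\<close>, a loss that
  disappears under the \<open>n\<close>-th root.\<close>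

lemma eroot_fekete:
  fixes E :: "nat \<Rightarrow> enat" and S :: "nat set"
  defines "F \<equiv> inf sequentially (principal S)"
    and "L \<equiv> (SUP n \<in> S \<inter> {0<..}. eroot n (E n))"
  assumes add: "\<And>m n. m \<in> S \<Longrightarrow> n \<in> S \<Longrightarrow> m + n \<in> S"
    and diff: "\<And>m n. m \<in> S \<Longrightarrow> n \<in> S \<Longrightarrow> m - n \<in> S"
    and one: "\<And>n. n \<in> S \<Longrightarrow> enat 1 \<le> E n"
    and mult: "\<And>m n M N. m \<in> S \<Longrightarrow> n \<in> S \<Longrightarrow> enat M \<le> E m \<Longrightarrow> enat N \<le> E n \<Longrightarrow>
                 enat (M * N) \<le> E (m + n)"
    and p: "p \<in> S" "0 < p"
  shows "F \<noteq> bot" and "((\<lambda>n. eroot n (E n)) \<longlongrightarrow> L) F"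
proof -
  have multiple: "j * n \<in> S" if "n \<in> S" for j n
  proof (induction j)
    case 0
    show ?case using diff[OF that that] by simp
  qed (simp add: add that)
  have power: "enat (N ^ j) \<le> E (j * n)" if "n \<in> S" "enat N \<le> E n" for j n N
  proof (induction j)
    case 0
    show ?case using one[OF multiple[OF that(1), of 0]] by simp
  next
    case (Suc j)
    show ?case using mult[OF that(1) multiple[OF that(1)] that(2) Suc] by simp
  qed
  \<comment> \<open>The multiples of \<open>p\<close> are unbounded in \<open>S\<close>.\<close>
  have "\<exists>n\<ge>k. n \<in> S" for k
    using multiple[OF p(1), of k] p(2) by (intro exI[of _ "k * p"]) simp
  then show "F \<noteq> bot"
    unfolding F_def trivial_limit_def eventually_inf_principal eventually_sequentially by blast
  have ev: "eventually P F" if "eventually (\<lambda>n. n \<in> S \<longrightarrow> 0 < n \<longrightarrow> P n) sequentially" for P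
    unfolding F_def eventually_inf_principal
    using that eventually_gt_at_top[of 0] by eventually_elim auto
  show "((\<lambda>n. eroot n (E n)) \<longlongrightarrow> L) F"
  proof (rule order_tendstoI)
    fix a assume "L < a"
    moreover have "eroot n (E n) \<le> L" if "n \<in> S" "0 < n" for n
      unfolding L_def using that by (intro SUP_upper) auto
    ultimately show "eventually (\<lambda>n. eroot n (E n) < a) F"
      by (intro ev always_eventually) (meson le_less_trans)
  next
    fix a assume "a < L"
    then obtain n0 where n0: "n0 \<in> S" "0 < n0" "a < eroot n0 (E n0)"
      unfolding L_def less_SUP_iff by auto
    show "eventually (\<lambda>n. a < eroot n (E n)) F"
    \<comment> \<open>Below 1 the bound \<open>1 \<le> E n\<close> suffices; otherwise the numbers
      chosen next exceed 1, as monotonicity in the exponent requires.\<close>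
    proof (cases "a < 1")
      case True
      have "a < eroot n (E n)" if "n \<in> S" "0 < n" for n
      proof -
        have "ereal 1 \<le> eroot n (E n)"
          using that one by (subst ereal_le_eroot_iff) (auto intro!: exI[of _ 1])
        then show ?thesis using True by (metis one_ereal_def less_le_trans)
      qed
      then show ?thesis by (intro ev always_eventually) auto
    next
      case False
      \<comment> \<open>Two numbers are placed in the gap: \<open>y\<close> is reached at
        \<open>n0\<close> and \<open>x\<close> at all large \<open>n\<close>, the powers of
        \<open>y / x\<close> paying for the incomplete last block.\<close>
      obtain y where y: "a < ereal y" "ereal y < eroot n0 (E n0)"
        using ereal_dense2[OF n0(3)] by blast
      obtain x where x: "a < ereal x" "ereal x < ereal y"
        using ereal_dense2[OF y(1)] by blast
      have x1: "1 < x"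
        using False x(1) by (metis ereal_less(2) less_ereal.simps(1) not_less one_ereal_def order_le_less_trans)
      have xy: "x < y" using x(2) by simp
      obtain N where N: "enat N \<le> E n0" "y ^ n0 \<le> real N"
        using less_imp_le[OF y(2)] x1 xy ereal_le_eroot_iff[of y n0 "E n0"] n0(2) by auto
      have yx: "1 < y / x"
        using x1 xy by simp
      obtain k where "y ^ n0 < (y / x) ^ k"
        using real_arch_pow[OF yx] by blast
      then have "y ^ n0 \<le> (y / x) ^ n" if "n \<ge> k" for n
        using power_increasing[OF that, of "y / x"] yx by linarith
      then have "eventually (\<lambda>n. y ^ n0 \<le> (y / x) ^ n) sequentially"
        by (auto simp: eventually_sequentially)
      then have "eventually (\<lambda>n. n \<in> S \<longrightarrow> 0 < n \<longrightarrow> a < eroot n (E n)) sequentially"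
      proof (eventually_elim, intro impI)
        fix n assume n: "y ^ n0 \<le> (y / x) ^ n" "n \<in> S" "0 < n"
        define q where "q = n div n0"
        have qn: "q * n0 + n mod n0 = n" by (simp add: q_def)
        \<comment> \<open>As a difference of elements of \<open>S\<close>, the remainder lies in
          \<open>S\<close>.\<close>
        then have "n mod n0 = n - q * n0" by linarith
        then have "n mod n0 \<in> S" using diff[OF n(2) multiple[OF n0(1)]] by simp
        then have "enat (N ^ q * 1) \<le> E (q * n0 + n mod n0)"
          using n0 N by (intro mult multiple power one)
        then have Nq: "enat (N ^ q) \<le> E n" by (simp only: qn mult_1_right)
        have "x ^ n * y ^ n0 \<le> y ^ n"
          using n(1) x1 by (simp add: power_divide field_simps)
        \<comment> \<open>Rounding \<open>n\<close> up to whole blocks costs at most a factor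
          \<open>y ^ n0\<close>, which then cancels against the one on the left.\<close>
        also have "\<dots> \<le> y ^ (q * n0 + n0)"
          using x1 xy qn mod_less_divisor[OF n0(2), of n] by (intro power_increasing) linarith+
        also have "\<dots> = (y ^ n0) ^ q * y ^ n0"
          by (simp add: power_add power_mult[symmetric] mult.commute)
        finally have "x ^ n \<le> (y ^ n0) ^ q"
          using x1 xy by simp
        also have "\<dots> \<le> real (N ^ q)"
          using N(2) x1 xy by (simp add: power_mono)
        finally have "ereal x \<le> eroot n (E n)"
          using Nq x1 n(3) by (subst ereal_le_eroot_iff) auto
        then show "a < eroot n (E n)" using x(1) by (rule less_le_trans[rotated])
      qed
      then show ?thesis by (rule ev)
    qed
  qed
qed

section \<open>The limit \<open>xi\<close> as a supremum\<close>

text \<open>Integrality of \<open>(1 - \<alpha>) * n\<close> follows from that of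
  \<open>\<alpha> * n\<close>, so one condition describes the index set of
  \<open>xi \<alpha> (1 - \<alpha>)\<close>.\<close>

definition admissible :: "rat \<Rightarrow> nat set" where
  "admissible \<alpha> = {n. \<alpha> * of_nat n \<in> \<int>}"

lemma of_nat_nat_floor:
  fixes x :: rat
  assumes "x \<in> \<int>" "0 \<le> x"
  shows "of_nat (nat \<lfloor>x\<rfloor>) = x"
  using assms by (auto elim!: Ints_cases)

lemma admissibleE:
  assumes "n \<in> admissible \<alpha>" "0 \<le> \<alpha>" "\<alpha> \<le> 1"
  obtains d k where "\<alpha> * of_nat n = of_nat d" "(1 - \<alpha>) * of_nat n = of_nat k" "d + k = n"
proof
  let ?d = "nat \<lfloor>\<alpha> * of_nat n\<rfloor>" and ?k = "nat \<lfloor>(1 - \<alpha>) * of_nat n\<rfloor>"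
  have "(1 - \<alpha>) * of_nat n = of_nat n - \<alpha> * of_nat n" by (simp add: algebra_simps)
  then have "(1 - \<alpha>) * of_nat n \<in> \<int>"
    using assms(1) by (simp add: admissible_def)
  then show d: "\<alpha> * of_nat n = of_nat ?d" and k: "(1 - \<alpha>) * of_nat n = of_nat ?k"
    using assms of_nat_nat_floor by (simp_all add: admissible_def)
  have "(of_nat (?d + ?k) :: rat) = of_nat n"
    by (simp only: of_nat_add d[symmetric] k[symmetric]) (simp add: algebra_simps)
  then show "?d + ?k = n" by (simp only: of_nat_eq_iff)
qed

definition Xi_seq :: "rat \<Rightarrow> nat \<Rightarrow> enat" where
  "Xi_seq \<alpha> n = Xi (nat \<lfloor>\<alpha> * of_nat n\<rfloor>) (nat \<lfloor>(1 - \<alpha>) * of_nat n\<rfloor>)"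

lemma Xi_seq_eq:
  assumes "\<alpha> * of_nat n = of_nat d" "(1 - \<alpha>) * of_nat n = of_nat k"
  shows "Xi_seq \<alpha> n = Xi d k"
  by (simp add: Xi_seq_def assms)

lemma ex_admissible: "\<exists>p \<in> admissible \<alpha>. 0 < p"
proof -
  obtain a b where q: "\<alpha> = Fract a b" "0 < b" by (cases \<alpha>)
  then have "\<alpha> * of_nat (nat b) = of_int a"
    by (simp add: Fract_of_int_quotient)
  then have "nat b \<in> admissible \<alpha>"
    by (simp add: admissible_def)
  then show ?thesis using q(2) by (intro bexI[of _ "nat b"]) auto
qed

text \<open>On admissible indices both arguments of \<open>Xi\<close> are additive in
  \<open>n\<close> and sum to \<open>n\<close>, so supermultiplicativity feeds Fekete's argument. It
  yields the convergence that gives \<open>Lim\<close> its value; a supremum, unlike a limit, is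
  approached at a single index.\<close>

lemma xi_eq_SUP:
  assumes "0 \<le> \<alpha>" "\<alpha> \<le> 1"
  shows "xi \<alpha> (1 - \<alpha>) = (SUP n \<in> admissible \<alpha> \<inter> {0<..}. eroot n (Xi_seq \<alpha> n))"
proof -
  let ?S = "admissible \<alpha>"
  let ?L = "SUP n \<in> ?S \<inter> {0<..}. eroot n (Xi_seq \<alpha> n)"
  let ?F = "inf sequentially (principal ?S)"
  let ?d = "\<lambda>n. nat \<lfloor>\<alpha> * of_nat n\<rfloor>" and ?k = "\<lambda>n. nat \<lfloor>(1 - \<alpha>) * of_nat n\<rfloor>"
  have add: "m + n \<in> ?S" if "m \<in> ?S" "n \<in> ?S" for m n
    using that by (simp add: admissible_def ring_distribs)
  have diff: "m - n \<in> ?S" if "m \<in> ?S" "n \<in> ?S" for m n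
    using that by (cases "n \<le> m") (simp_all add: admissible_def of_nat_diff right_diff_distrib)
  have one: "enat 1 \<le> Xi_seq \<alpha> n" for n
    unfolding Xi_seq_def by (rule one_le_Xi)
  have mult: "enat (M * N) \<le> Xi_seq \<alpha> (m + n)"
    if mn: "m \<in> ?S" "n \<in> ?S" and MN: "enat M \<le> Xi_seq \<alpha> m" "enat N \<le> Xi_seq \<alpha> n" for m n M N
  proof -
    obtain d k where d: "\<alpha> * of_nat m = of_nat d" "(1 - \<alpha>) * of_nat m = of_nat k"
      using admissibleE[OF mn(1) assms] .
    obtain e l where e: "\<alpha> * of_nat n = of_nat e" "(1 - \<alpha>) * of_nat n = of_nat l"
      using admissibleE[OF mn(2) assms] .
    have "Xi_seq \<alpha> (m + n) = Xi (d + e) (k + l)"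
      by (rule Xi_seq_eq) (simp_all only: of_nat_add distrib_left d e)
    then show ?thesis
      using MN Xi_supermultiplicative by (simp only: Xi_seq_eq[OF d] Xi_seq_eq[OF e])
  qed
  obtain p where p: "p \<in> ?S" "0 < p" using ex_admissible by blast
  note fekete = eroot_fekete[of ?S "Xi_seq \<alpha>", OF add diff one mult p]
  have dk: "?d n + ?k n = n" if "n \<in> ?S" for n
    using admissibleE[OF that assms] by (metis floor_of_nat nat_int)
  have "{n. \<alpha> * of_nat n \<in> \<int> \<and> (1 - \<alpha>) * of_nat n \<in> \<int>} = ?S"
    by (auto simp: admissible_def left_diff_distrib)
  then have "xi \<alpha> (1 - \<alpha>) = Lim ?F (\<lambda>n. eroot (?d n + ?k n) (Xi (?d n) (?k n)))"
    by (simp add: xi_def Let_def)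
  also have "\<dots> = ?L"
  proof (rule tendsto_Lim)
    show "?F \<noteq> bot" by (rule fekete(1))
    have "eventually (\<lambda>n. eroot (?d n + ?k n) (Xi (?d n) (?k n)) = eroot n (Xi_seq \<alpha> n)) ?F"
      unfolding eventually_inf_principal by (auto simp: dk Xi_seq_def)
    then show "((\<lambda>n. eroot (?d n + ?k n) (Xi (?d n) (?k n))) \<longlongrightarrow> ?L) ?F"
      using fekete(2) by (simp add: tendsto_cong)
  qed
  finally show ?thesis .
qed

lemma one_le_xi:
  assumes "0 \<le> \<alpha>" "\<alpha> \<le> 1"
  shows "1 \<le> xi \<alpha> (1 - \<alpha>)"
proof -
  obtain p where p: "p \<in> admissible \<alpha>" "0 < p" using ex_admissible by blast
  have "ereal 1 \<le> eroot p (Xi_seq \<alpha> p)"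
    using p one_le_Xi by (subst ereal_le_eroot_iff) (auto simp: Xi_seq_def intro!: exI[of _ 1])
  also have "\<dots> \<le> xi \<alpha> (1 - \<alpha>)"
    unfolding xi_eq_SUP[OF assms] using p by (intro SUP_upper) auto
  finally show ?thesis by (simp add: one_ereal_def)
qed

section \<open>Mixing copies of two systems\<close>

text \<open>The two groups of copies have total sizes \<open>r * n * n'\<close> and
  \<open>s * n * n'\<close>, in proportion \<theta> to \<open>1 - \<theta>\<close>. With bounds
  written as exponentials, their weighted geometric mean is linear in \<open>u\<close> and
  \<open>v\<close>.\<close>

lemma Xi_seq_convex:
  fixes \<theta> :: rat
  assumes \<alpha>: "0 \<le> \<alpha>" "\<alpha> \<le> 1" and \<alpha>': "0 \<le> \<alpha>'" "\<alpha>' \<le> 1" and \<theta>: "0 \<le> \<theta>" "\<theta> \<le> 1"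
    and n: "n \<in> admissible \<alpha>" "0 < n" and n': "n' \<in> admissible \<alpha>'" "0 < n'"
    and u: "ereal (exp u) \<le> eroot n (Xi_seq \<alpha> n)"
    and v: "ereal (exp v) \<le> eroot n' (Xi_seq \<alpha>' n')"
  defines "\<alpha>'' \<equiv> \<theta> * \<alpha> + (1 - \<theta>) * \<alpha>'"
  shows "\<exists>m \<in> admissible \<alpha>''. 0 < m \<and>
    ereal (exp (of_rat \<theta> * u + of_rat (1 - \<theta>) * v)) \<le> eroot m (Xi_seq \<alpha>'' m)"
proof -
  obtain d k where d: "\<alpha> * of_nat n = of_nat d" "(1 - \<alpha>) * of_nat n = of_nat k"
    using admissibleE[OF n(1) \<alpha>] .
  obtain e l where e: "\<alpha>' * of_nat n' = of_nat e" "(1 - \<alpha>') * of_nat n' = of_nat l"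
    using admissibleE[OF n'(1) \<alpha>'] .
  obtain q where q: "q \<in> admissible \<theta>" "0 < q" using ex_admissible by blast
  obtain r s where r: "\<theta> * of_nat q = of_nat r" "(1 - \<theta>) * of_nat q = of_nat s"
    using admissibleE[OF q(1) \<theta>] .
  obtain M where M: "enat M \<le> Xi d k" "exp u ^ n \<le> real M"
    using u n(2) by (auto simp: ereal_le_eroot_iff Xi_seq_eq[OF d])
  obtain N where N: "enat N \<le> Xi e l" "exp v ^ n' \<le> real N"
    using v n'(2) by (auto simp: ereal_le_eroot_iff Xi_seq_eq[OF e])
  let ?m = "q * n * n'" and ?i = "r * n'" and ?j = "s * n"
  \<comment> \<open>The combined parameters are exactly the shares \<open>\<alpha>''\<close> and
    \<open>1 - \<alpha>''\<close> of \<open>?m\<close>, so that \<open>Xi_seq_eq\<close>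
    applies.\<close>
  have \<alpha>''m: "\<alpha>'' * of_nat ?m = of_nat (?i * d + ?j * e)"
  proof -
    have "\<alpha>'' * of_nat ?m = (\<theta> * of_nat q) * of_nat n' * (\<alpha> * of_nat n)
        + ((1 - \<theta>) * of_nat q) * of_nat n * (\<alpha>' * of_nat n')"
      by (simp add: \<alpha>''_def algebra_simps)
    then show ?thesis unfolding d e r by simp
  qed
  have \<beta>''m: "(1 - \<alpha>'') * of_nat ?m = of_nat (?i * k + ?j * l)"
  proof -
    have "(1 - \<alpha>'') * of_nat ?m = (\<theta> * of_nat q) * of_nat n' * ((1 - \<alpha>) * of_nat n)
        + ((1 - \<theta>) * of_nat q) * of_nat n * ((1 - \<alpha>') * of_nat n')"
      by (simp add: \<alpha>''_def algebra_simps)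
    then show ?thesis unfolding d e r by simp
  qed
  have adm: "?m \<in> admissible \<alpha>''"
    unfolding admissible_def mem_Collect_eq \<alpha>''m by (rule Ints_of_nat)
  have Xi: "enat (M ^ ?i * N ^ ?j) \<le> Xi_seq \<alpha>'' ?m"
    unfolding Xi_seq_eq[OF \<alpha>''m \<beta>''m] using M(1) N(1) by (intro Xi_supermultiplicative Xi_power)
  have "of_rat (\<theta> * of_nat q) = (of_rat (of_nat r) :: real)"
    "of_rat ((1 - \<theta>) * of_nat q) = (of_rat (of_nat s) :: real)"
    by (simp_all only: r)
  then have rs: "of_rat \<theta> * real q = real r" "of_rat (1 - \<theta>) * real q = real s"
    by (simp_all only: of_rat_mult of_rat_of_nat_eq)
  have "exp (of_rat \<theta> * u + of_rat (1 - \<theta>) * v) ^ ?m =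
      exp ((of_rat \<theta> * real q) * real n' * (real n * u) + (of_rat (1 - \<theta>) * real q) * real n * (real n' * v))"
    by (simp add: exp_of_nat_mult[symmetric] algebra_simps)
  \<comment> \<open>Regrouping isolates the powers that \<open>M\<close> and \<open>N\<close>
    bound.\<close>
  also have "\<dots> = (exp u ^ n) ^ ?i * (exp v ^ n') ^ ?j"
    unfolding rs by (simp add: exp_of_nat_mult[symmetric] exp_add algebra_simps)
  also have "\<dots> \<le> real M ^ ?i * real N ^ ?j"
    using M(2) N(2) by (intro mult_mono power_mono) auto
  also have "\<dots> = real (M ^ ?i * N ^ ?j)" by simp
  finally have "ereal (exp (of_rat \<theta> * u + of_rat (1 - \<theta>) * v)) \<le> eroot ?m (Xi_seq \<alpha>'' ?m)"
    using Xi q(2) n(2) n'(2) by (subst ereal_le_eroot_iff) auto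
  then show ?thesis using adm q(2) n(2) n'(2) by (intro bexI[of _ ?m]) auto
qed

section \<open>Extended logarithms and log-concavity\<close>

lemma ereal_le_elog_iff: "ereal u \<le> elog x \<longleftrightarrow> ereal (exp u) \<le> x"
proof (cases x)
  case (real r)
  then show ?thesis
    using less_le_trans[OF exp_gt_zero, of u r] by (cases "0 < r") (auto simp: elog_def ln_ge_iff)
qed (auto simp: elog_def)

lemma ereal_less_elog_iff: "ereal u < elog x \<longleftrightarrow> ereal (exp u) < x"
proof (cases x)
  case (real r)
  then show ?thesis
    using less_trans[OF exp_gt_zero, of u r] exp_less_cancel_iff[of u "ln r"]
    by (cases "0 < r") (auto simp: elog_def)
qed (auto simp: elog_def)

text \<open>Reduces an inequality that may involve \<infinity> to real numbers strictly below
  \<open>a\<close> and \<open>b\<close>. Excluding \<open>-\<infinity>\<close> avoids opposite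
  infinities in the sum, and positive weights allow division by them.\<close>

lemma ereal_convex_combination_le:
  fixes a b c :: ereal and s t :: real
  assumes "0 < s" "0 < t" and ab: "a \<noteq> -\<infinity>" "b \<noteq> -\<infinity>"
    and le: "\<And>u v. ereal u < a \<Longrightarrow> ereal v < b \<Longrightarrow> ereal (s * u + t * v) \<le> c"
  shows "ereal s * a + ereal t * b \<le> c"
proof -
  have approx: "\<exists>u. ereal u < a \<and> z < s * u" if "ereal z < ereal s * a" "0 < s" for s z a
  proof -
    have "ereal (z / s) < a"
      using that by (cases a) (auto simp: field_simps)
    then obtain u where "z / s < u" "ereal u < a"
      using ereal_dense2 by force
    then show ?thesis using that(2) by (auto simp: field_simps)
  qed
  show ?thesis
  proof (rule dense_le)
    fix w assume "w < ereal s * a + ereal t * b"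
    then obtain w' where w': "w < ereal w'" "ereal w' < ereal s * a + ereal t * b"
      using ereal_dense2 by blast
    \<comment> \<open>Two finite terms share the slack \<open>p + q - w'\<close> equally; an
      infinite term absorbs whatever the other leaves.\<close>
    have "\<exists>y z. w' = y + z \<and> ereal y < ereal s * a \<and> ereal z < ereal t * b"
    proof (cases "ereal s * a"; cases "ereal t * b")
      fix p q assume pq: "ereal s * a = ereal p" "ereal t * b = ereal q"
      then have "w' < p + q" using w'(2) by simp
      then show ?thesis
        unfolding pq by (intro exI[of _ "p - (p + q - w') / 2"] exI[of _ "q - (p + q - w') / 2"]) (simp add: field_simps)
    next
      fix p assume pq: "ereal s * a = ereal p" "ereal t * b = \<infinity>"
      then show ?thesis unfolding pq by (intro exI[of _ "p - 1"] exI[of _ "w' - (p - 1)"]) simp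
    next
      fix q assume pq: "ereal s * a = \<infinity>" "ereal t * b = ereal q"
      then show ?thesis unfolding pq by (intro exI[of _ "w' - (q - 1)"] exI[of _ "q - 1"]) simp
    next
      assume pq: "ereal s * a = \<infinity>" "ereal t * b = \<infinity>"
      then show ?thesis unfolding pq by (intro exI[of _ "w'"] exI[of _ "0"]) simp
    qed (use ab assms(1,2) in \<open>cases a; cases b; simp\<close>)+
    then obtain y z where yz: "w' = y + z" "ereal y < ereal s * a" "ereal z < ereal t * b" by blast
    obtain u where u: "ereal u < a" "y < s * u" using approx[OF yz(2) assms(1)] by blast
    obtain v where v: "ereal v < b" "z < t * v" using approx[OF yz(3) assms(2)] by blast
    have "ereal w' \<le> ereal (s * u + t * v)" using yz(1) u(2) v(2) by simp
    then show "w \<le> c" using w'(1) le[OF u(1) v(1)] by order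
  qed
qed

theorem proposition2p5:
  fixes \<alpha> \<alpha>' \<alpha>'' \<theta> :: rat
  assumes "0 < \<alpha>" and "\<alpha> < 1"
    and "0 < \<alpha>'" and "\<alpha>' < 1"
    and "0 \<le> \<theta>" and "\<theta> \<le> 1"
    and "\<alpha>'' = \<theta> * \<alpha> + (1 - \<theta>) * \<alpha>'"
  shows "elog (xi \<alpha>'' (1 - \<alpha>'')) \<ge>
           ereal (of_rat \<theta>) * elog (xi \<alpha> (1 - \<alpha>)) +
           ereal (of_rat (1 - \<theta>)) * elog (xi \<alpha>' (1 - \<alpha>'))"
proof -
  \<comment> \<open>The approximation from below needs positive weights. At the endpoints the zero
    weight kills its logarithm, even an infinite one.\<close>
  consider "\<theta> = 0" | "\<theta> = 1" | "0 < \<theta>" "\<theta> < 1"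
    using assms(5,6) by linarith
  then show ?thesis
  proof cases
    case 3
    have \<alpha>: "0 \<le> \<alpha>" "\<alpha> \<le> 1" and \<alpha>': "0 \<le> \<alpha>'" "\<alpha>' \<le> 1"
      using assms by auto
    have "0 \<le> \<alpha>''"
      using assms by simp
    have "\<alpha>'' \<le> \<theta> * 1 + (1 - \<theta>) * 1"
      unfolding assms(7) using assms by (intro add_mono mult_left_mono) auto
    then have "\<alpha>'' \<le> 1" by simp
    have nonneg: "elog (xi \<beta> (1 - \<beta>)) \<noteq> -\<infinity>" if "0 \<le> \<beta>" "\<beta> \<le> 1" for \<beta>
      using one_le_xi[OF that] ereal_le_elog_iff[of 0 "xi \<beta> (1 - \<beta>)"] by (auto simp: one_ereal_def)
    show ?thesis
    proof (rule ereal_convex_combination_le)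
      show "0 < (of_rat \<theta> :: real)" "0 < (of_rat (1 - \<theta>) :: real)"
        using 3 by (simp_all add: zero_less_of_rat_iff)
      fix u v assume "ereal u < elog (xi \<alpha> (1 - \<alpha>))" "ereal v < elog (xi \<alpha>' (1 - \<alpha>'))"
      \<comment> \<open>A number strictly below a supremum is beaten by a single term, which
        provides \<open>n\<close> and \<open>n'\<close>.\<close>
      then obtain n n' where "n \<in> admissible \<alpha>" "0 < n" "ereal (exp u) < eroot n (Xi_seq \<alpha> n)"
        and "n' \<in> admissible \<alpha>'" "0 < n'" "ereal (exp v) < eroot n' (Xi_seq \<alpha>' n')"
        unfolding ereal_less_elog_iff xi_eq_SUP[OF \<alpha>] xi_eq_SUP[OF \<alpha>'] less_SUP_iff by auto
      then obtain m where m: "m \<in> admissible \<alpha>''" "0 < m"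
        "ereal (exp (of_rat \<theta> * u + of_rat (1 - \<theta>) * v)) \<le> eroot m (Xi_seq \<alpha>'' m)"
        using Xi_seq_convex[OF \<alpha> \<alpha>' assms(5,6), of n n' u v] less_imp_le unfolding assms(7) by blast
      then show "ereal (of_rat \<theta> * u + of_rat (1 - \<theta>) * v) \<le> elog (xi \<alpha>'' (1 - \<alpha>''))"
        unfolding ereal_le_elog_iff xi_eq_SUP[OF \<open>0 \<le> \<alpha>''\<close> \<open>\<alpha>'' \<le> 1\<close>]
        by (intro SUP_upper2[of m]) auto
    qed (use nonneg \<alpha> \<alpha>' in auto)
  qed (use assms in \<open>auto simp: zero_ereal_def[symmetric]\<close>)
qed

end
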